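(* A compact Hausdorff space $X$ is a $CZ$-space if, and only if, $X$ is scattered.
   Context: A subset $A\subseteq X$ is a zero-set if $A=f^{-1}(0)$ for some continuous $f:X\to\mathbb{R}$; a cozero-set is the complement of a zero-set. A $Zer_\sigma$-set is a countable union of zero-sets, and a $Coz_\delta$-set is a countable intersection of cozero-sets. $X$ is a $CZ$-space if every $Zer_\sigma$-set of $X$ is a $Coz_\delta$-set. A space $X$ is scattered if every nonempty subspace of $X$ has an isolated point. *)

theory Defs
  imports "HOL-Analysis.Analysis"
begin

definition zero_set_in :: "'a topology \<Rightarrow> 'a set \<Rightarrow> bool" where
  "zero_set_in X A \<longleftrightarrow>
     (\<exists>f. continuous_map X euclideanreal f \<and> A = {x \<in> topspace X. f x = 0})"

definition cozero_set_in :: "'a topology \<Rightarrow> 'a set \<Rightarrow> bool" where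
  "cozero_set_in X A \<longleftrightarrow> (\<exists>Z. zero_set_in X Z \<and> A = topspace X - Z)"

text \<open>
  Indexing countable families by \<^typ>\<open>nat\<close> loses nothing: repetitions are allowed, and the
  union and the intersection (taken in \<open>X\<close>) of the empty family, namely \<open>{}\<close> and
  \<open>topspace X\<close>, are themselves a zero-set and a cozero-set.
\<close>

definition zer_sigma_in :: "'a topology \<Rightarrow> 'a set \<Rightarrow> bool" where
  "zer_sigma_in X A \<longleftrightarrow> (\<exists>Z :: nat \<Rightarrow> 'a set. (\<forall>n. zero_set_in X (Z n)) \<and> A = (\<Union>n. Z n))"

definition coz_delta_in :: "'a topology \<Rightarrow> 'a set \<Rightarrow> bool" where
  "coz_delta_in X A \<longleftrightarrow> (\<exists>C :: nat \<Rightarrow> 'a set. (\<forall>n. cozero_set_in X (C n)) \<and> A = (\<Inter>n. C n))"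

definition CZ_space :: "'a topology \<Rightarrow> bool" where
  "CZ_space X \<longleftrightarrow> (\<forall>A. zer_sigma_in X A \<longrightarrow> coz_delta_in X A)"

definition scattered_space :: "'a topology \<Rightarrow> bool" where
  "scattered_space X \<longleftrightarrow>
     (\<forall>S. S \<subseteq> topspace X \<and> S \<noteq> {} \<longrightarrow> (\<exists>x\<in>S. openin (subtopology X S) {x}))"

end

theory Submission
  imports Defs
begin

text \<open>
  If \<open>X\<close> is scattered, then every continuous image of \<open>X\<close> in a metric space is countable.
  Combining the functions defining the zero-sets of a union \<open>A\<close> into one map from \<open>X\<close> to a
  countable power of the line, the complement of \<open>A\<close> is a union of fibres of this map, hence
  of countably many zero-sets.

  If a nonempty subspace of \<open>X\<close> has no isolated point, a Cantor scheme of open sets meeting it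
  yields a continuous real function \<open>f\<close> on \<open>X\<close> whose image contains the open unit interval.
  The preimage of the rationals under \<open>f\<close> is a countable union of zero-sets; were it also a
  countable intersection of cozero-sets, the irrationals in the interval would be covered by
  countably many compact sets of irrationals, contradicting the Baire category theorem.
\<close>

section \<open>Zero-sets and countable intersections of cozero-sets\<close>

lemma zero_set_in_level:
  assumes "continuous_map X euclideanreal f"
  shows "zero_set_in X {x \<in> topspace X. f x = c}"
  unfolding zero_set_in_def
proof (intro exI conjI)
  show "continuous_map X euclideanreal (\<lambda>x. f x - c)"
    by (intro continuous_intros assms)
qed auto

lemma zero_set_in_fibre:
  fixes F :: "'a \<Rightarrow> 'b::metric_space"
  assumes "continuous_map X euclidean F"
  shows "zero_set_in X {x \<in> topspace X. F x = y}"
proof -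
  have "continuous_map X euclideanreal ((\<lambda>z. dist z y) \<circ> F)"
    by (rule continuous_map_compose[OF assms]) (auto intro!: continuous_intros)
  from zero_set_in_level[OF this, of 0] show ?thesis
    by (simp add: o_def)
qed

lemma zero_set_in_empty: "zero_set_in X {}"
  using zero_set_in_level[of X "\<lambda>_. 0" 1] by simp

lemma closedin_zero_set:
  assumes "zero_set_in X Z"
  shows "closedin X Z"
proof -
  obtain f where f: "continuous_map X euclideanreal f" "Z = {x \<in> topspace X. f x \<in> {0}}"
    using assms unfolding zero_set_in_def by auto
  show ?thesis
    unfolding f(2) by (rule closedin_continuous_map_preimage[OF f(1)]) auto
qed

lemma coz_delta_inI:
  assumes "countable \<Z>" "\<And>Z. Z \<in> \<Z> \<Longrightarrow> zero_set_in X Z" "A = topspace X - \<Union>\<Z>"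
  shows "coz_delta_in X A"
proof -
  \<comment> \<open>Adding \<open>{}\<close>, itself a zero-set, leaves the union unchanged and
    makes the family nonempty, so that \<open>from_nat_into\<close> enumerates it even when \<Z> is
    empty.\<close>
  define Z where "Z = from_nat_into (insert {} \<Z>)"
  have r: "range Z = insert {} \<Z>"
    unfolding Z_def by (rule range_from_nat_into) (use assms in auto)
  have z: "zero_set_in X (Z n)" for n
    using r assms(2) zero_set_in_empty[of X] by (metis insertE rangeI)
  show ?thesis
    unfolding coz_delta_in_def
  proof (intro exI[of _ "\<lambda>n. topspace X - Z n"] conjI allI)
    show "cozero_set_in X (topspace X - Z n)" for n
      using z unfolding cozero_set_in_def by blast
    have "\<Union>\<Z> = \<Union>(range Z)"
      unfolding r by simp
    then show "A = (\<Inter>n. topspace X - Z n)"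
      unfolding assms(3) by auto
  qed
qed

lemma coz_delta_inE:
  assumes "coz_delta_in X A"
  obtains Z :: "nat \<Rightarrow> 'a set" where "\<And>n. zero_set_in X (Z n)" "topspace X - A = (\<Union>n. Z n)"
proof -
  obtain C :: "nat \<Rightarrow> 'a set" where C: "\<And>n. cozero_set_in X (C n)" "A = (\<Inter>n. C n)"
    using assms unfolding coz_delta_in_def by blast
  obtain Z where Z: "\<And>n. zero_set_in X (Z n)" "\<And>n. C n = topspace X - Z n"
    using C(1) unfolding cozero_set_in_def by metis
  have "Z n \<subseteq> topspace X" for n
    using Z(1) unfolding zero_set_in_def by auto
  with C(2) Z(2) have "topspace X - A = (\<Union>n. Z n)"
    by auto
  with Z(1) show thesis
    using that by blast
qed

section \<open>Countable metric images of scattered compact spaces\<close>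

lemma countable_image_if_countable_off_nbhds:
  fixes F :: "'a \<Rightarrow> 'b::metric_space"
  assumes "\<And>n. countable (F ` {z \<in> N. inverse (real (Suc n)) \<le> dist (F z) y})"
  shows "countable (F ` N)"
proof -
  have "F ` N \<subseteq> insert y (\<Union>n. F ` {z \<in> N. inverse (real (Suc n)) \<le> dist (F z) y})"
  proof (intro image_subsetI)
    fix z assume z: "z \<in> N"
    show "F z \<in> insert y (\<Union>n. F ` {z \<in> N. inverse (real (Suc n)) \<le> dist (F z) y})"
    proof (cases "F z = y")
      case False
      then obtain n where "inverse (real (Suc n)) < dist (F z) y"
        using reals_Archimedean[of "dist (F z) y"] by auto
      with z show ?thesis
        by (auto intro!: less_imp_le)
    qed simp
  qed
  then show ?thesis
    by (rule countable_subset) (simp add: assms del: of_nat_Suc)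
qed

text \<open>Let \<open>V\<close> be the union of all open sets with countable image. By finite
  subcovers, compact subsets of \<open>V\<close> have countable image. If \<open>V\<close> were not
  everything, its complement would have an isolated point \<open>x\<close>, with a closed
  neighbourhood \<open>N\<close> lying in \<open>V\<close> except for \<open>x\<close>. The parts of
  \<open>N\<close> where \<open>F\<close> stays away from \<open>F x\<close> are compact subsets of
  \<open>V\<close>, so \<open>N\<close> has countable image and \<open>x\<close> belongs to
  \<open>V\<close> after all.\<close>

lemma scattered_compact_countable_image:
  fixes F :: "'a \<Rightarrow> 'b::metric_space"
  assumes comp: "compact_space X" and haus: "Hausdorff_space X" and scat: "scattered_space X"
    and cont: "continuous_map X euclidean F"
  shows "countable (F ` topspace X)"
proof -
  define V where "V = \<Union>{U. openin X U \<and> countable (F ` U)}"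
  have opV: "openin X V"
    unfolding V_def by blast
  have cpt: "countable (F ` K)" if K: "compactin X K" "K \<subseteq> V" for K
  proof -
    obtain \<F> where \<F>: "finite \<F>" "\<F> \<subseteq> {U. openin X U \<and> countable (F ` U)}" "K \<subseteq> \<Union>\<F>"
      using compactinD[OF K(1), of "{U. openin X U \<and> countable (F ` U)}"] K(2)
      unfolding V_def by auto
    have "countable (\<Union>U\<in>\<F>. F ` U)"
      using \<F>(1,2) by (auto intro: countable_finite)
    then show ?thesis
      by (rule countable_subset[rotated]) (use \<F>(3) in auto)
  qed
  have "topspace X - V = {}"
  proof (rule ccontr)
    assume "topspace X - V \<noteq> {}"
    then obtain x where x: "x \<in> topspace X - V"
      "openin (subtopology X (topspace X - V)) {x}"
      using scat unfolding scattered_space_def by blast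
    then obtain U where U: "openin X U" "{x} = U \<inter> (topspace X - V)"
      by (auto simp: openin_subtopology)
    have "neighbourhood_base_of (closedin X) X"
      using compact_Hausdorff_imp_regular_space[OF comp haus] neighbourhood_base_of_closedin
      by blast
    then obtain W N where W: "openin X W" "closedin X N" "x \<in> W" "W \<subseteq> N" "N \<subseteq> U"
      using U unfolding neighbourhood_base_of by (metis Int_iff insertI1)
    have "countable (F ` N)"
    proof (rule countable_image_if_countable_off_nbhds)
      fix n
      let ?K = "{z \<in> N. inverse (real (Suc n)) \<le> dist (F z) (F x)}"
      have "closedin X {z \<in> topspace X. F z \<in> {w. inverse (real (Suc n)) \<le> dist w (F x)}}"
        by (rule closedin_continuous_map_preimage[OF cont])
          (auto intro!: closed_Collect_le continuous_intros)
      then have "closedin X (N \<inter> {z \<in> topspace X. F z \<in> {w. inverse (real (Suc n)) \<le> dist w (F x)}})"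
        using W(2) by blast
      also have "N \<inter> {z \<in> topspace X. F z \<in> {w. inverse (real (Suc n)) \<le> dist w (F x)}} = ?K"
        using closedin_subset[OF W(2)] by auto
      finally have "compactin X ?K"
        using comp closedin_compact_space by blast
      \<comment> \<open>The only point of \<open>N\<close> outside \<open>V\<close> is
        \<open>x\<close>, and \<open>x\<close> is not in \<open>?K\<close> because its distance
        there is 0.\<close>
      moreover have "?K \<subseteq> V"
      proof
        fix z assume z: "z \<in> ?K"
        then have "z \<noteq> x"
          by auto
        with z U(2) W(5) closedin_subset[OF W(2)] show "z \<in> V"
          by blast
      qed
      ultimately show "countable (F ` ?K)"
        by (rule cpt)
    qed
    then have "countable (F ` W)"
      using W(4) by (meson countable_subset image_mono)
    then have "x \<in> V"
      using W(1,3) unfolding V_def by blast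
    with x show False
      by blast
  qed
  then show ?thesis
    using cpt[of "topspace X"] comp by (auto simp: compact_space_def)
qed

lemma scattered_compact_imp_CZ:
  assumes "compact_space X" "Hausdorff_space X" "scattered_space X"
  shows "CZ_space X"
  unfolding CZ_space_def
proof (intro allI impI)
  fix A assume "zer_sigma_in X A"
  then obtain Z :: "nat \<Rightarrow> 'a set" where Z: "\<And>n. zero_set_in X (Z n)" "A = (\<Union>n. Z n)"
    unfolding zer_sigma_in_def by blast
  obtain f where f: "\<And>n. continuous_map X euclideanreal (f n)"
    "\<And>n. Z n = {x \<in> topspace X. f n x = 0}"
    using Z(1) unfolding zero_set_in_def by metis
  define F where "F = (\<lambda>x n. f n x)"
  have "continuous_map X (product_topology (\<lambda>_::nat. euclideanreal) UNIV) F"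
    unfolding continuous_map_componentwise_UNIV F_def using f(1) by simp
  then have F: "continuous_map X euclidean F"
    unfolding euclidean_product_topology .
  \<comment> \<open>These are the values of \<open>F\<close> at the points outside \<open>A\<close>:
    whether a point lies in \<open>A\<close> depends only on its value under
    \<open>F\<close>.\<close>
  define Y where "Y = {y \<in> F ` topspace X. \<forall>n. y n \<noteq> 0}"
  have cY: "countable Y"
    unfolding Y_def
    by (rule countable_subset[OF _ scattered_compact_countable_image[OF assms F]]) auto
  show "coz_delta_in X A"
  proof (rule coz_delta_inI)
    show "countable ((\<lambda>y. {x \<in> topspace X. F x = y}) ` Y)"
      using cY by simp
    show "zero_set_in X S" if "S \<in> (\<lambda>y. {x \<in> topspace X. F x = y}) ` Y" for S
      using that zero_set_in_fibre[OF F] by auto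
    have "x \<in> A \<longleftrightarrow> F x \<notin> Y" if "x \<in> topspace X" for x
      using that unfolding Z(2) f(2) Y_def F_def by auto
    moreover have "A \<subseteq> topspace X"
      unfolding Z(2) f(2) by auto
    ultimately show "A = topspace X - \<Union> ((\<lambda>y. {x \<in> topspace X. F x = y}) ` Y)"
      by auto
  qed
qed

section \<open>Cantor schemes in spaces that are not scattered\<close>

text \<open>As \<open>S\<close> has no isolated point, \<open>U\<close> contains two points of
  \<open>S\<close>. They are separated by disjoint open sets, and regularity shrinks these so that
  even the closures stay inside them and inside \<open>U\<close>.\<close>

lemma split_open_meeting_dense_in_itself:
  assumes haus: "Hausdorff_space X" and reg: "regular_space X"
    and S: "S \<subseteq> topspace X" "\<forall>x\<in>S. \<not> openin (subtopology X S) {x}"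
    and U: "openin X U" "U \<inter> S \<noteq> {}"
  obtains V W where "openin X V" "V \<inter> S \<noteq> {}" "X closure_of V \<subseteq> U"
    "openin X W" "W \<inter> S \<noteq> {}" "X closure_of W \<subseteq> U"
    "X closure_of V \<inter> X closure_of W = {}"
proof -
  obtain x where x: "x \<in> U" "x \<in> S"
    using U by blast
  have "\<not> U \<inter> S \<subseteq> {x}"
  proof
    assume "U \<inter> S \<subseteq> {x}"
    with x have "{x} = U \<inter> S"
      by blast
    with U(1) S(2) x(2) show False
      by (auto simp: openin_subtopology)
  qed
  then obtain y where y: "y \<in> U" "y \<in> S" "y \<noteq> x"
    by blast
  obtain A B where AB: "openin X A" "openin X B" "x \<in> A" "y \<in> B" "disjnt A B"
    using haus x y S(1) unfolding Hausdorff_space_def by (metis subsetD)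
  have shrink: "\<exists>V. openin X V \<and> z \<in> V \<and> X closure_of V \<subseteq> T" if "openin X T" "z \<in> T" for T z
    using reg that unfolding neighbourhood_base_of_closedin[symmetric] neighbourhood_base_of
    by (meson closure_of_minimal subset_trans)
  obtain V where V: "openin X V" "x \<in> V" "X closure_of V \<subseteq> U \<inter> A"
    using shrink[of "U \<inter> A" x] U(1) AB x by blast
  obtain W where W: "openin X W" "y \<in> W" "X closure_of W \<subseteq> U \<inter> B"
    using shrink[of "U \<inter> B" y] U(1) AB y by blast
  show thesis
  proof (rule that)
    show "V \<inter> S \<noteq> {}" "W \<inter> S \<noteq> {}"
      using V(2) W(2) x(2) y(2) by blast+
    show "X closure_of V \<subseteq> U" "X closure_of W \<subseteq> U"
      using V(3) W(3) by blast+
    show "X closure_of V \<inter> X closure_of W = {}"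
      using V(3) W(3) AB(5) unfolding disjnt_def by blast
  qed (fact V(1) W(1))+
qed

text \<open>The newest term is placed at the head, so \<open>branch x (Suc n)\<close> is a child of
  \<open>branch x n\<close> in the scheme below.\<close>

fun branch :: "(nat \<Rightarrow> 'b) \<Rightarrow> nat \<Rightarrow> 'b list" where
  "branch x 0 = []"
| "branch x (Suc n) = x n # branch x n"

lemma length_branch [simp]: "length (branch x n) = n"
  by (induction n) auto

text \<open>
  Words are read from right to left: the children of the node \<open>s\<close> of the scheme are
  \<open>True # s\<close> and \<open>False # s\<close>.
\<close>

lemma dense_in_itself_imp_Cantor_scheme:
  assumes haus: "Hausdorff_space X" and reg: "regular_space X"
    and S: "S \<subseteq> topspace X" "S \<noteq> {}" "\<forall>x\<in>S. \<not> openin (subtopology X S) {x}"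
  obtains G :: "bool list \<Rightarrow> 'a set"
  where "\<And>s. X closure_of G s \<noteq> {}"
    "\<And>b s. X closure_of G (b # s) \<subseteq> X closure_of G s"
    "\<And>s t. length s = length t \<Longrightarrow> s \<noteq> t \<Longrightarrow> X closure_of G s \<inter> X closure_of G t = {}"
proof -
  let ?P = "\<lambda>U. openin X U \<and> U \<inter> S \<noteq> {}"
  \<comment> \<open>The condition on \<open>U\<close> stands inside the existential quantifiers, so
    that the choice functions \<open>R0\<close> and \<open>R1\<close> are total.\<close>
  have "\<forall>U. \<exists>V W. ?P U \<longrightarrow> ?P V \<and> ?P W \<and> X closure_of V \<subseteq> U \<and> X closure_of W \<subseteq> U \<and>
      X closure_of V \<inter> X closure_of W = {}"
    using split_open_meeting_dense_in_itself[OF haus reg S(1,3)] by metis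
  then obtain R0 R1 where R: "\<And>U. ?P U \<Longrightarrow> ?P (R0 U) \<and> ?P (R1 U) \<and> X closure_of R0 U \<subseteq> U \<and>
      X closure_of R1 U \<subseteq> U \<and> X closure_of R0 U \<inter> X closure_of R1 U = {}"
    by metis
  define G where "G = rec_list (topspace X) (\<lambda>b (_::bool list) U. if b then R1 U else R0 U)"
  have G: "G [] = topspace X" "G (b # s) = (if b then R1 (G s) else R0 (G s))" for b s
    by (simp_all add: G_def)
  have P: "?P (G s)" for s
  proof (induction s)
    case Nil
    then show ?case
      using S by (auto simp: G)
  next
    case (Cons b s)
    then show ?case
      using R[OF Cons] by (simp add: G)
  qed
  have sub: "X closure_of G (b # s) \<subseteq> G s" for b s
    using R[OF P] by (simp add: G)
  have cl: "G s \<subseteq> X closure_of G s" for s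
    using P[of s] by (simp add: closure_of_subset openin_subset)
  show thesis
  proof (rule that)
    show "X closure_of G s \<noteq> {}" for s
      using P[of s] cl[of s] by blast
    show "X closure_of G (b # s) \<subseteq> X closure_of G s" for b s
      using sub cl by blast
    show "X closure_of G s \<inter> X closure_of G t = {}" if "length s = length t" "s \<noteq> t" for s t
      using that
    proof (induction s t rule: list_induct2)
      case (Cons b s c t)
      show ?case
      \<comment> \<open>Distinct children of one node are disjoint by the splitting; children of
        distinct nodes lie in the closures of their parents, which are disjoint by
        induction.\<close>
      proof (cases "s = t")
        case True
        with Cons.prems show ?thesis
          using R[OF P[of t]] by (cases b; cases c) (auto simp: G)
      next
        case False
        with Cons.IH sub[of b s] sub[of c t] cl[of s] cl[of t] show ?thesis
          by blast
      qed
    qed simp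
  qed
qed

section \<open>Binary expansions and a map covering the unit interval\<close>

text \<open>The dyadic truncations \<open>a n / 2 ^ n\<close> converge to \<open>r\<close>, and
  consecutive ones differ by one binary digit over \<open>2 ^ Suc n\<close>, so the series
  telescopes. The bounds on \<open>r\<close> make the initial truncation 0.\<close>

lemma binary_expansion:
  fixes r :: real
  assumes "0 \<le> r" "r < 1"
  obtains x :: "nat \<Rightarrow> bool" where "(\<lambda>n. of_bool (x n) / 2 ^ Suc n) sums r"
proof -
  define a where "a = (\<lambda>n. \<lfloor>2 ^ n * r\<rfloor>)"
  define x where "x = (\<lambda>n. a (Suc n) \<noteq> 2 * a n)"
  have step: "of_int (a (Suc n)) / 2 ^ Suc n - of_int (a n) / 2 ^ n = (of_bool (x n) / 2 ^ Suc n :: real)"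
    for n
  proof -
    have "a (Suc n) = 2 * a n \<or> a (Suc n) = 2 * a n + 1"
      unfolding a_def power_Suc mult.assoc by linarith
    then have "of_int (a (Suc n)) = 2 * of_int (a n) + (of_bool (x n) :: real)"
      unfolding x_def by auto
    then show ?thesis
      by (simp add: field_simps)
  qed
  have "(\<lambda>n. of_int (a n) / 2 ^ n) \<longlonglongrightarrow> r"
  proof (rule tendsto_sandwich)
    show "(\<lambda>n. r - (1/2) ^ n) \<longlonglongrightarrow> r"
      by (rule tendsto_eq_intros LIMSEQ_power_zero | simp)+
    show "\<forall>\<^sub>F n in sequentially. r - (1/2) ^ n \<le> of_int (a n) / 2 ^ n"
    proof (intro always_eventually allI)
      fix n
      have "2 ^ n * r - 1 \<le> of_int (a n)"
        unfolding a_def by linarith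
      then have "(2 ^ n * r - 1) / 2 ^ n \<le> of_int (a n) / 2 ^ n"
        by (rule divide_right_mono) simp
      then show "r - (1/2) ^ n \<le> of_int (a n) / 2 ^ n"
        by (simp add: diff_divide_distrib power_one_over)
    qed
    show "\<forall>\<^sub>F n in sequentially. of_int (a n) / 2 ^ n \<le> r"
    proof (intro always_eventually allI)
      fix n
      have "of_int (a n) \<le> 2 ^ n * r"
        unfolding a_def by linarith
      then show "of_int (a n) / 2 ^ n \<le> r"
        by (simp add: field_simps)
    qed
  qed simp
  from telescope_sums[OF this] have "(\<lambda>n. of_bool (x n) / 2 ^ Suc n) sums (r - of_int (a 0) / 2 ^ 0)"
    unfolding step .
  moreover have "a 0 = 0"
    using assms unfolding a_def by (simp add: floor_eq_iff)
  ultimately show thesis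
    using that by simp
qed

lemma continuous_map_dyadic_series:
  fixes h :: "nat \<Rightarrow> 'a \<Rightarrow> real"
  assumes "\<And>n. continuous_map X euclideanreal (h n)"
    and "\<And>n x. x \<in> topspace X \<Longrightarrow> \<bar>h n x\<bar> \<le> 1"
  shows "continuous_map X euclideanreal (\<lambda>x. \<Sum>n. h n x / 2 ^ Suc n)"
proof -
  have "uniform_limit (topspace X) (\<lambda>n x. \<Sum>i<n. h i x / 2 ^ Suc i) (\<lambda>x. \<Sum>n. h n x / 2 ^ Suc n)
      sequentially"
  proof (rule Weierstrass_m_test)
    show "norm (h n x / 2 ^ Suc n) \<le> (1/2) ^ Suc n" if "x \<in> topspace X" for n x
      using assms(2)[OF that, of n] by (simp add: field_simps power_divide)
    show "summable (\<lambda>n. (1/2::real) ^ Suc n)"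
      unfolding summable_Suc_iff by (rule summable_geometric) simp
  qed
  then have lim: "\<And>e. 0 < e \<Longrightarrow> \<forall>\<^sub>F n in sequentially. \<forall>x\<in>topspace X.
      dist (\<Sum>i<n. h i x / 2 ^ Suc i) (\<Sum>n. h n x / 2 ^ Suc n) < e"
    unfolding uniform_limit_iff by blast
  \<comment> \<open>\<open>Met_TC.mtopology\<close> is the usual topology of the reals, in the form
    in which the uniform limit theorem speaks of it.\<close>
  have "continuous_map X Met_TC.mtopology (\<lambda>x. \<Sum>n. h n x / 2 ^ Suc n)"
  proof (rule Met_TC.continuous_map_uniform_limit)
    have "continuous_map X euclideanreal (\<lambda>x. \<Sum>i<n. h i x / 2 ^ Suc i)" for n
      by (intro continuous_map_sum continuous_map_real_divide assms(1)) auto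
    then show "\<forall>\<^sub>F n in sequentially. continuous_map X Met_TC.mtopology (\<lambda>x. \<Sum>i<n. h i x / 2 ^ Suc i)"
      by simp
  qed (use lim in auto)
  then show ?thesis
    by simp
qed

text \<open>A Urysohn function \<open>h n\<close> reads off the \<open>n\<close>-th binary digit on
  the closed sets of the scheme at level \<open>Suc n\<close>. Summing these digits with dyadic
  weights sends a point on the branch \<open>x\<close> to the number with binary digits
  \<open>x\<close>.\<close>

lemma not_scattered_imp_map_onto_interval:
  assumes comp: "compact_space X" and haus: "Hausdorff_space X" and nscat: "\<not> scattered_space X"
  obtains f where "continuous_map X euclideanreal f" "{0<..<1} \<subseteq> f ` topspace X"
proof -
  have reg: "regular_space X" and nor: "normal_space X"
    using comp haus compact_Hausdorff_imp_regular_space compact_Hausdorff_or_regular_imp_normal_space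
    by blast+
  obtain S where S: "S \<subseteq> topspace X" "S \<noteq> {}" "\<forall>x\<in>S. \<not> openin (subtopology X S) {x}"
    using nscat unfolding scattered_space_def by blast
  obtain G :: "bool list \<Rightarrow> 'a set"
    where ne: "\<And>s. X closure_of G s \<noteq> {}"
      and dec: "\<And>b s. X closure_of G (b # s) \<subseteq> X closure_of G s"
      and disj: "\<And>s t. length s = length t \<Longrightarrow> s \<noteq> t \<Longrightarrow> X closure_of G s \<inter> X closure_of G t = {}"
    by (fact dense_in_itself_imp_Cantor_scheme[OF haus reg S])
  \<comment> \<open>Since words grow at the head, \<open>L n b\<close> gathers the nodes of length
    \<open>Suc n\<close> whose last chosen digit is \<open>b\<close>. It is a finite union of closed
    sets.\<close>
  define L where "L = (\<lambda>n b. \<Union>s\<in>{s. length s = n}. X closure_of G (b # s))"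
  have finite_words: "finite {s :: bool list. length s = n}" for n
    using finite_lists_length_eq[of "UNIV :: bool set" n] by simp
  have "\<exists>h. continuous_map X (top_of_set {0..1::real}) h \<and> h ` L n False \<subseteq> {0} \<and> h ` L n True \<subseteq> {1}"
    for n
  proof -
    have "closedin X (L n b)" for b
      unfolding L_def using finite_words by (intro closedin_Union) auto
    moreover have "disjnt (L n False) (L n True)"
      unfolding disjnt_iff
    proof (intro allI notI)
      fix p assume "p \<in> L n False \<and> p \<in> L n True"
      then obtain s t where "length s = n" "length t = n"
        "p \<in> X closure_of G (False # s)" "p \<in> X closure_of G (True # t)"
        unfolding L_def by auto
      then show False
        using disj[of "False # s" "True # t"] by auto
    qed
    ultimately show ?thesis
      using Urysohn_lemma[OF nor, of "L n False" "L n True" 0 1] by (metis zero_le_one)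
  qed
  then obtain h where h: "\<And>n. continuous_map X (top_of_set {0..1::real}) (h n)"
    "\<And>n. h n ` L n False \<subseteq> {0}" "\<And>n. h n ` L n True \<subseteq> {1}"
    by metis
  define f where "f = (\<lambda>x. \<Sum>n. h n x / 2 ^ Suc n)"
  have "continuous_map X euclideanreal f"
    unfolding f_def
  proof (rule continuous_map_dyadic_series)
    show "continuous_map X euclideanreal (h n)" for n
      using h(1) by (auto simp: continuous_map_in_subtopology)
    show "\<bar>h n x\<bar> \<le> 1" if "x \<in> topspace X" for n x
    proof -
      have "h n x \<in> {0..1}"
        using h(1)[of n] that by (auto simp: continuous_map_in_subtopology)
      then show ?thesis by auto
    qed
  qed
  moreover have "r \<in> f ` topspace X" if r: "r \<in> {0<..<1}" for r
  proof -
    obtain x :: "nat \<Rightarrow> bool" where x: "(\<lambda>n. of_bool (x n) / 2 ^ Suc n) sums r"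
      using r binary_expansion[of r] by auto
    \<comment> \<open>Compactness provides a point lying on the whole branch given by the digits of
      \<open>r\<close>.\<close>
    have "(\<Inter>n. X closure_of G (branch x n)) \<noteq> {}"
    proof (rule compact_space_imp_nest[OF comp])
      show "decseq (\<lambda>n. X closure_of G (branch x n))"
        by (rule decseq_SucI) (simp add: dec)
    qed (simp_all add: ne)
    then obtain p where p: "\<And>n. p \<in> X closure_of G (branch x n)"
      by blast
    have "h n p = of_bool (x n)" for n
    proof -
      have "p \<in> L n (x n)"
        unfolding L_def using p[of "Suc n"] by force
      then show ?thesis
        using h(2,3)[of n] by (cases "x n") auto
    qed
    then have "f p = r"
      unfolding f_def using x by (simp add: sums_iff)
    moreover have "p \<in> topspace X"
      using p[of 0] closure_of_subset_topspace[of X] by blast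
    ultimately show ?thesis
      by blast
  qed
  ultimately show thesis
    using that by blast
qed

section \<open>Baire category and the failure of the CZ property\<close>

lemma dense_rationals: "closure \<rat> = (UNIV :: real set)"
proof -
  have "x \<in> closure \<rat>" for x :: real
    unfolding closure_approachable
  proof (intro allI impI)
    fix e :: real assume "0 < e"
    then obtain q where "q \<in> \<rat>" "x < q" "q < x + e"
      using Rats_dense_in_real[of x "x + e"] by auto
    then show "\<exists>y\<in>\<rat>. dist y x < e"
      by (intro bexI[of _ q]) (auto simp: dist_real_def)
  qed
  then show ?thesis by blast
qed

text \<open>Each \<open>- K n\<close> is open and contains the dense set of rationals, and the
  complement of a point is open and dense. By Baire the intersection of all these sets is dense, so
  it meets the interval, in an irrational point outside every \<open>K n\<close>.\<close>

lemma interval_not_covered_by_rationals_and_closed_irrational_sets: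
  fixes K :: "nat \<Rightarrow> real set"
  assumes "a < b" "\<And>n. closed (K n)" "\<And>n. K n \<inter> \<rat> = {}"
  shows "\<not> {a<..<b} \<subseteq> \<rat> \<union> (\<Union>n. K n)"
proof -
  let ?\<G> = "range (\<lambda>n. - K n) \<union> (\<lambda>q. - {q}) ` \<rat>"
  have "UNIV \<subseteq> closure (\<Inter>?\<G>)"
  proof (rule Baire)
    show "countable ?\<G>"
      using countable_rat by auto
    have "closure (- K n) = UNIV" for n
      using closure_mono[of \<rat> "- K n"] assms(3)[of n] dense_rationals by blast
    moreover have "closure (- {q}) = UNIV" for q :: real
      by (simp add: closure_complement interior_singleton)
    ultimately show "openin (top_of_set UNIV) T \<and> UNIV \<subseteq> closure T" if "T \<in> ?\<G>" for T
      using that assms(2) by auto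
  qed simp
  moreover have "open {a<..<b}" "{a<..<b} \<noteq> {}"
    using assms(1) by auto
  ultimately have "{a<..<b} \<inter> \<Inter>?\<G> \<noteq> {}"
    using open_Int_closure_eq_empty[of "{a<..<b}" "\<Inter>?\<G>"] by blast
  then show ?thesis
    by blast
qed

lemma zer_sigma_in_preimage_rationals:
  assumes "continuous_map X euclideanreal f"
  shows "zer_sigma_in X {x \<in> topspace X. f x \<in> \<rat>}"
proof -
  obtain q :: "nat \<Rightarrow> real" where q: "range q = \<rat>"
    using range_from_nat_into[OF _ countable_rat] Rats_0 by blast
  have "{x \<in> topspace X. f x \<in> \<rat>} = (\<Union>n. {x \<in> topspace X. f x = q n})"
    unfolding q[symmetric] by blast
  then show ?thesis
    unfolding zer_sigma_in_def using zero_set_in_level[OF assms]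
    by (intro exI[of _ "\<lambda>n. {x \<in> topspace X. f x = q n}"]) simp
qed

lemma compact_CZ_imp_scattered:
  assumes comp: "compact_space X" and haus: "Hausdorff_space X" and CZ: "CZ_space X"
  shows "scattered_space X"
proof (rule ccontr)
  assume "\<not> scattered_space X"
  then obtain f where f: "continuous_map X euclideanreal f" "{0<..<1} \<subseteq> f ` topspace X"
    by (rule not_scattered_imp_map_onto_interval[OF comp haus])
  let ?A = "{x \<in> topspace X. f x \<in> \<rat>}"
  have A: "coz_delta_in X ?A"
    using CZ zer_sigma_in_preimage_rationals[OF f(1)] unfolding CZ_space_def by blast
  obtain Z :: "nat \<Rightarrow> 'a set"
    where Z: "\<And>n. zero_set_in X (Z n)" "topspace X - ?A = (\<Union>n. Z n)"
    by (fact coz_delta_inE[OF A])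
  have "closed (f ` Z n)" for n
  proof -
    have "compactin X (Z n)"
      using closedin_compact_space[OF comp closedin_zero_set[OF Z(1)]] .
    then have "compact (f ` Z n)"
      using image_compactin[OF _ f(1)] by simp
    then show ?thesis
      by (rule compact_imp_closed)
  qed
  moreover have "f ` Z n \<inter> \<rat> = {}" for n
  proof -
    have "Z n \<subseteq> topspace X - ?A"
      unfolding Z(2) by (rule UN_upper) simp
    then show ?thesis
      by auto
  qed
  ultimately have "\<not> {0<..<1} \<subseteq> \<rat> \<union> (\<Union>n. f ` Z n)"
    using interval_not_covered_by_rationals_and_closed_irrational_sets[of 0 1 "\<lambda>n. f ` Z n"]
    by simp
  moreover have "f x \<in> \<rat> \<union> (\<Union>n. f ` Z n)" if "x \<in> topspace X" for x
  proof (cases "f x \<in> \<rat>")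
    case False
    with that have "x \<in> (\<Union>n. Z n)"
      unfolding Z(2)[symmetric] by simp
    then show ?thesis
      by auto
  qed simp
  then have "f ` topspace X \<subseteq> \<rat> \<union> (\<Union>n. f ` Z n)"
    by (rule image_subsetI)
  ultimately show False
    using f(2) by (meson subset_trans)
qed

theorem theorem2p9:
  fixes X :: "'a topology"
  assumes "compact_space X" and "Hausdorff_space X"
  shows "CZ_space X \<longleftrightarrow> scattered_space X"
  using assms compact_CZ_imp_scattered scattered_compact_imp_CZ by blast

end
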